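(* For every $r\in[1,\infty)$, $$\sup_{n\geqslant 1}\ \sup_{f\in\mathbb C^{\mathbb I^n}\setminus\{0\}}\frac{\big\|V_r(S_kf:k\in\{0,1,\dots,n\})\big\|_{\ell^2(\mathbb I^n)}}{\big\|f\big\|_{\ell^2(\mathbb I^n)}}=\infty,$$ where $n$ ranges over the positive integers.
   Context: For a positive integer $n$, $\mathbb I^n:=\{0,1\}^n$ is the hypercube with the Hamming metric $d(x,y):=|\{j:x(j)\neq y(j)\}|$. For $k\in\{0,1,\dots,n\}$ and $f:\mathbb I^n\to\mathbb C$, the spherical mean is $$S_kf(x):=\frac1{\binom nk}\sum_{y\in\mathbb I^n,\ d(x,y)=k}f(y),\qquad x\in\mathbb I^n.$$ The norm is $\|f\|_{\ell^2(\mathbb I^n)}:=\big(\sum_{x\in\mathbb I^n}|f(x)|^2\big)^{1/2}$. For $r\in[1,\infty)$, $Z\subseteq\{0,1,\dots,n\}$ and $x\in\mathbb I^n$, the $r$-variation seminorm is $$V_r(S_kf(x):k\in Z):=\max_{k_0<k_1<\dots<k_J,\ k_j\in Z}\Big(\sum_{j=1}^J|S_{k_{j-1}}f(x)-S_{k_j}f(x)|^r\Big)^{1/r},$$ the maximum being over all finite nonempty strictly increasing sequences in $Z$. $V_r(S_kf:k\in Z)$ denotes the function $\mathbb I^n\ni x\mapsto V_r(S_kf(x):k\in Z)$. *)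

theory Defs
  imports Complex_Main "HOL-Library.FuncSet" "HOL-Library.Extended_Real"
begin

text \<open>Points of the cube are extensional functions on the coordinate set \<open>{1..n}\<close>,
  so that there are exactly \<open>2 ^ n\<close> of them and the sums over the cube below are finite.\<close>

definition hypercube :: "nat \<Rightarrow> (nat \<Rightarrow> nat) set"
  where "hypercube n = {1..n} \<rightarrow>\<^sub>E {0, 1}"

definition hamming_dist :: "nat \<Rightarrow> (nat \<Rightarrow> nat) \<Rightarrow> (nat \<Rightarrow> nat) \<Rightarrow> nat"
  where "hamming_dist n x y = card {j \<in> {1..n}. x j \<noteq> y j}"

definition spherical_mean ::
    "nat \<Rightarrow> nat \<Rightarrow> ((nat \<Rightarrow> nat) \<Rightarrow> complex) \<Rightarrow> (nat \<Rightarrow> nat) \<Rightarrow> complex"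
  where "spherical_mean n k f x =
    1 / of_nat (n choose k) * (\<Sum>y\<in>{y \<in> hypercube n. hamming_dist n x y = k}. f y)"

definition l2_norm :: "nat \<Rightarrow> ((nat \<Rightarrow> nat) \<Rightarrow> 'a::real_normed_vector) \<Rightarrow> real"
  where "l2_norm n f = sqrt (\<Sum>x\<in>hypercube n. (norm (f x))\<^sup>2)"

text \<open>A list \<open>ks\<close> encodes \<open>k\<^sub>0 < \<dots> < k\<^sub>J\<close> with \<open>J = length ks - 1\<close>.  The case \<open>J = 0\<close> is
  admitted and contributes the value \<open>0\<close>.\<close>

definition increasing_seqs :: "nat set \<Rightarrow> nat list set"
  where "increasing_seqs Z = {ks. ks \<noteq> [] \<and> sorted_wrt (<) ks \<and> set ks \<subseteq> Z}"

definition variation :: "real \<Rightarrow> nat set \<Rightarrow> (nat \<Rightarrow> complex) \<Rightarrow> real"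
  where "variation r Z a =
    Max ((\<lambda>ks. (\<Sum>j = 1..length ks - 1. cmod (a (ks ! (j - 1)) - a (ks ! j)) powr r) powr (1 / r))
         ` increasing_seqs Z)"

text \<open>The maximum in \<^const>\<open>variation\<close> is over a finite nonempty set whenever
  \<open>Z\<close> is finite and nonempty.\<close>

lemma finite_increasing_seqs: "finite Z \<Longrightarrow> finite (increasing_seqs Z)"
  unfolding increasing_seqs_def
  by (rule finite_subset[OF _ finite_subset_distinct[of Z]])
     (auto dest: strict_sorted_imp_sorted simp: strict_sorted_iff)

lemma increasing_seqs_nonempty: "Z \<noteq> {} \<Longrightarrow> increasing_seqs Z \<noteq> {}"
proof -
  assume "Z \<noteq> {}"
  then obtain k where "k \<in> Z" by blast
  then have "[k] \<in> increasing_seqs Z" by (simp add: increasing_seqs_def)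
  then show ?thesis by blast
qed

lemma finite_hypercube: "finite (hypercube n)"
  unfolding hypercube_def by (intro finite_PiE) auto

end

(* The parity character f x = (-1)^(x(1) + ... + x(n)) is an eigenfunction of every spherical mean,
   S_k f = (-1)^k f.  Along the sequence 0 < 1 < ... < n each jump therefore has modulus 2, so
   V_r(S_k f) = 2 n^(1/r) at every point of the cube, which is unbounded in n. *)
theory Submission imports Defs
begin

text \<open>The restriction to the cube makes this an extensional function, as the index set of the
  inner supremum requires.\<close>

definition parity_char :: "nat \<Rightarrow> (nat \<Rightarrow> nat) \<Rightarrow> complex"
  where "parity_char n = (\<lambda>x\<in>hypercube n. \<Prod>j\<in>{1..n}. (- 1) ^ x j)"

lemma norm_parity_char: "x \<in> hypercube n \<Longrightarrow> norm (parity_char n x) = 1"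
  by (simp add: parity_char_def norm_power flip: prod_norm)

text \<open>The product factors over coordinates, and each coordinate where \<open>x\<close> and
  \<open>y\<close> differ contributes exactly one sign change.\<close>

lemma parity_char_hamming:
  assumes "x \<in> hypercube n" "y \<in> hypercube n"
  shows "parity_char n y = (- 1) ^ hamming_dist n x y * parity_char n x"
proof -
  have "parity_char n y = (\<Prod>j\<in>{1..n}. (if x j \<noteq> y j then - 1 else 1) * (- 1) ^ x j)"
  proof -
    have "(- 1 :: complex) ^ y j = (if x j \<noteq> y j then - 1 else 1) * (- 1) ^ x j" if "j \<in> {1..n}" for j
    proof -
      have "x j \<in> {0, 1}" "y j \<in> {0, 1}"
        using assms that by (auto simp: hypercube_def PiE_iff)
      then show ?thesis
        by auto
    qed
    then show ?thesis
      using assms(2) unfolding parity_char_def by (simp only: restrict_apply' cong: prod.cong)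
  qed
  also have "\<dots> = (\<Prod>j\<in>{1..n}. if x j \<noteq> y j then - 1 else 1) * parity_char n x"
    using assms by (simp add: prod.distrib parity_char_def)
  also have "(\<Prod>j\<in>{1..n}. if x j \<noteq> y j then - 1 else 1) = (- 1 :: complex) ^ hamming_dist n x y"
    by (simp add: prod.If_cases hamming_dist_def Int_def)
  finally show ?thesis .
qed

text \<open>A point of the sphere is determined by the set of coordinates where it differs from
  \<open>x\<close>, and every \<open>k\<close>-subset of \<open>{1..n}\<close> occurs.\<close>

lemma card_hamming_sphere:
  assumes "x \<in> hypercube n"
  shows "card {y \<in> hypercube n. hamming_dist n x y = k} = n choose k"
proof -
  \<comment> \<open>The inverse map flips \<open>x\<close> on \<open>T\<close>. The subtraction on
    naturals is a true flip because \<open>x j\<close> is 0 or 1.\<close>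
  let ?flip = "\<lambda>T. \<lambda>j\<in>{1..n}. if j \<in> T then 1 - x j else x j"
  have x01: "x j = 0 \<or> x j = 1" if "j \<in> {1..n}" for j
    using assms that by (auto simp: hypercube_def PiE_iff)
  have diff: "{j \<in> {1..n}. x j \<noteq> ?flip T j} = T" if "T \<subseteq> {1..n}" for T
  proof (rule set_eqI)
    fix j
    show "j \<in> {j \<in> {1..n}. x j \<noteq> ?flip T j} \<longleftrightarrow> j \<in> T"
      using that x01[of j] by (cases "j \<in> T") auto
  qed
  have "bij_betw (\<lambda>y. {j \<in> {1..n}. x j \<noteq> y j})
      {y \<in> hypercube n. hamming_dist n x y = k} {T. T \<subseteq> {1..n} \<and> card T = k}"
  proof (rule bij_betw_byWitness[where f' = ?flip])
    show "\<forall>y\<in>{y \<in> hypercube n. hamming_dist n x y = k}. ?flip {j \<in> {1..n}. x j \<noteq> y j} = y"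
    proof
      fix y assume "y \<in> {y \<in> hypercube n. hamming_dist n x y = k}"
      then have y: "y \<in> hypercube n" by simp
      show "?flip {j \<in> {1..n}. x j \<noteq> y j} = y"
      proof (rule ext)
        fix j
        have "y j \<in> {0, 1}" if "j \<in> {1..n}"
          using y that by (auto simp: hypercube_def PiE_iff)
        \<comment> \<open>Off \<open>{1..n}\<close> extensionality forces both functions to the same
          default value.\<close>
        moreover have "y j = undefined" if "j \<notin> {1..n}"
          using y that unfolding hypercube_def by (rule PiE_arb)
        ultimately show "?flip {j \<in> {1..n}. x j \<noteq> y j} j = y j"
          using x01[of j] by (cases "j \<in> {1..n}") auto
      qed
    qed
    show "\<forall>T\<in>{T. T \<subseteq> {1..n} \<and> card T = k}. {j \<in> {1..n}. x j \<noteq> ?flip T j} = T"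
      using diff by blast
    show "(\<lambda>y. {j \<in> {1..n}. x j \<noteq> y j}) ` {y \<in> hypercube n. hamming_dist n x y = k}
        \<subseteq> {T. T \<subseteq> {1..n} \<and> card T = k}"
      by (auto simp: hamming_dist_def)
    show "?flip ` {T. T \<subseteq> {1..n} \<and> card T = k} \<subseteq> {y \<in> hypercube n. hamming_dist n x y = k}"
    proof safe
      fix T assume T: "T \<subseteq> {1..n}" "k = card T"
      show "?flip T \<in> hypercube n"
        using x01 by (fastforce simp: hypercube_def PiE_iff)
      show "hamming_dist n x (?flip T) = card T"
        unfolding hamming_dist_def diff[OF T(1)] ..
    qed
  qed
  then show ?thesis
    by (simp add: bij_betw_same_card n_subsets)
qed

text \<open>The character is constant on each sphere around \<open>x\<close>, so averaging returns
  that constant; \<open>k \<le> n\<close> makes the binomial coefficient nonzero, so it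
  cancels.\<close>

lemma spherical_mean_parity_char:
  assumes "x \<in> hypercube n" "k \<le> n"
  shows "spherical_mean n k (parity_char n) x = (- 1) ^ k * parity_char n x"
proof -
  have "(\<Sum>y\<in>{y \<in> hypercube n. hamming_dist n x y = k}. parity_char n y)
      = (\<Sum>y\<in>{y \<in> hypercube n. hamming_dist n x y = k}. (- 1) ^ k * parity_char n x)"
    using parity_char_hamming[OF assms(1)] by (intro sum.cong) auto
  also have "\<dots> = of_nat (n choose k) * ((- 1) ^ k * parity_char n x)"
    by (simp add: card_hamming_sphere[OF assms(1)])
  finally show ?thesis
    using assms(2) by (simp add: spherical_mean_def)
qed

text \<open>The full sequence from 0 to \<open>n\<close> is one of the finitely many competitors in
  the maximum.\<close>

lemma variation_ge_consecutive:
  "(\<Sum>j = 1..n. cmod (a (j - 1) - a j) powr r) powr (1 / r) \<le> variation r {0..n} a"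
proof -
  have "[0..<Suc n] \<in> increasing_seqs {0..n}"
    by (auto simp: increasing_seqs_def simp del: upt_Suc)
  moreover have "(\<Sum>j = 1..length [0..<Suc n] - 1.
        cmod (a ([0..<Suc n] ! (j - 1)) - a ([0..<Suc n] ! j)) powr r)
      = (\<Sum>j = 1..n. cmod (a (j - 1) - a j) powr r)"
    by (intro sum.cong) (auto simp del: upt_Suc)
  ultimately show ?thesis
    unfolding variation_def by (intro Max_ge) (auto intro: finite_increasing_seqs rev_image_eqI)
qed

lemma variation_parity_char_ge:
  assumes "r > 0" "x \<in> hypercube n"
  shows "2 * real n powr (1 / r)
    \<le> variation r {0..n} (\<lambda>k. spherical_mean n k (parity_char n) x)"
proof -
  let ?S = "\<lambda>k. spherical_mean n k (parity_char n) x"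
  have "cmod (?S (j - 1) - ?S j) = 2" if "j \<in> {1..n}" for j
  proof -
    \<comment> \<open>Writing \<open>j\<close> as a successor removes the truncated subtraction, so
      that the eigenvalues at \<open>i\<close> and \<open>Suc i\<close> are visibly
      opposite.\<close>
    from that obtain i where j: "j = Suc i" "i < n"
      by (cases j) auto
    have "?S i - ?S j = 2 * ((- 1) ^ i * parity_char n x)"
      using j assms(2) by (simp add: spherical_mean_parity_char)
    then show ?thesis
      using j assms(2) by (simp add: norm_mult norm_power norm_parity_char)
  qed
  then have "(\<Sum>j = 1..n. cmod (?S (j - 1) - ?S j) powr r) = real n * 2 powr r"
    by simp
  moreover have "(real n * 2 powr r) powr (1 / r) = 2 * real n powr (1 / r)"
    using assms(1) by (simp add: powr_mult powr_powr)
  ultimately show ?thesis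
    using variation_ge_consecutive[where a = ?S and n = n and r = r] by simp
qed

text \<open>This licenses division by the norm and also shows that the character is not the zero
  function.\<close>

lemma l2_norm_parity_char_pos: "l2_norm n (parity_char n) > 0"
proof -
  have "hypercube n \<noteq> {}"
    by (simp add: hypercube_def PiE_eq_empty_iff)
  then show ?thesis
    by (simp add: l2_norm_def norm_parity_char card_gt_0_iff finite_hypercube)
qed

lemma variation_ratio_parity_char_ge:
  assumes "r > 0"
  shows "2 * real n powr (1 / r)
    \<le> l2_norm n (\<lambda>x. variation r {0..n} (\<lambda>k. spherical_mean n k (parity_char n) x))
      / l2_norm n (parity_char n)" (is "?c \<le> l2_norm n ?V / _")
proof -
  \<comment> \<open>As the character has modulus 1, scaling its norm by \<open>?c\<close> gives the
    norm of the constant \<open>?c\<close>, which is then compared pointwise with the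
    variation.\<close>
  have "?c * l2_norm n (parity_char n) = sqrt (\<Sum>x\<in>hypercube n. ?c\<^sup>2)"
    by (simp add: l2_norm_def norm_parity_char real_sqrt_mult)
  also have "\<dots> \<le> l2_norm n ?V"
    unfolding l2_norm_def
  proof (intro real_sqrt_le_mono sum_mono power_mono)
    fix x assume "x \<in> hypercube n"
    then show "?c \<le> norm (?V x)"
      using variation_parity_char_ge[OF assms] by (fastforce intro: order_trans[OF _ abs_ge_self])
  qed simp
  finally show ?thesis
    by (simp add: pos_le_divide_eq l2_norm_parity_char_pos)
qed

theorem theorem1p1:
  fixes r :: real
  assumes "r \<ge> 1"
  shows "(SUP n\<in>{1::nat..}.
           SUP f\<in>(hypercube n \<rightarrow>\<^sub>E (UNIV :: complex set)) - {\<lambda>x\<in>hypercube n. 0}.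
             ereal (l2_norm n (\<lambda>x. variation r {0..n} (\<lambda>k. spherical_mean n k f x)) / l2_norm n f))
         = \<infinity>" (is "?sup = _")
proof (rule ereal_top)
  fix B :: real
  \<comment> \<open>The ceiling gives \<open>n\<close> at least \<open>\<bar>B\<bar> powr r\<close>,
    whose \<open>r\<close>-th root is \<open>\<bar>B\<bar>\<close>; the successor ensures
    \<open>n \<ge> 1\<close>.\<close>
  define n where "n = Suc (nat \<lceil>\<bar>B\<bar> powr r\<rceil>)"
  have "\<bar>B\<bar> powr r \<le> real n"
    unfolding n_def by linarith
  then have "(\<bar>B\<bar> powr r) powr (1 / r) \<le> real n powr (1 / r)"
    using assms by (intro powr_mono2) auto
  then have "B \<le> 2 * real n powr (1 / r)"
    using assms by (simp add: powr_powr)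
  also have "\<dots> \<le> l2_norm n (\<lambda>x. variation r {0..n} (\<lambda>k. spherical_mean n k (parity_char n) x))
      / l2_norm n (parity_char n)"
    using assms by (intro variation_ratio_parity_char_ge) simp
  finally have B: "ereal B \<le> ereal \<dots>"
    by simp
  \<comment> \<open>Equality would give norm 0, against positivity.\<close>
  have "parity_char n \<noteq> (\<lambda>x\<in>hypercube n. 0)"
    using l2_norm_parity_char_pos[of n] by (auto simp: l2_norm_def)
  then have "parity_char n \<in> (hypercube n \<rightarrow>\<^sub>E UNIV) - {\<lambda>x\<in>hypercube n. 0}"
    by (simp add: parity_char_def)
  moreover have "n \<in> {1..}"
    by (simp add: n_def)
  ultimately show "ereal B \<le> ?sup"
    using B by (blast intro: SUP_upper2)
qed

end
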